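(* Let $(\mathcal{L},T_* )$ be a real-valued logic. Then $\mathcal{L}$ satisfies principle (P1) if, and only if, $\mathcal{L}$ is an extension of G\"odel logic $\mathbf{G}$.
   Context: Formulas $\mathrm{Form}$ are built from countably many propositional variables $X_1,X_2,\dots$ with primitive connectives $\to$, $\&$, $\bot$; abbreviations: $\neg\alpha:=\alpha\to\bot$, $\alpha\wedge\beta:=\alpha\&(\alpha\to\beta)$, $\alpha\vee\beta:=((\alpha\to\beta)\to\beta)\wedge((\beta\to\alpha)\to\alpha)$, $\alpha\leftrightarrow\beta:=(\alpha\to\beta)\&(\beta\to\alpha)$. $\mathbf{BL}$ is H\'ajek's Basic Logic (the logic of all continuous t-norms and their residua). An extension of $\mathbf{BL}$ is a consistent set of formulas closed under the consequence relation of $\mathbf{BL}$ and under substitutions. A t-norm here is a continuous, associative, commutative binary operation $*$ on $[0,1]$ with neutral element $1$, non-decreasing in each argument; its residuum is $a\to_* b:=\max\{c\in[0,1]: a*c\le b\}$. An algebra of truth values $T_*$ is a subalgebra (containing $0,1$, closed under $*$ and $\to_*$) of a BL-algebra $([0,1],*,\to_*,0)$ with $*$ a continuous t-norm; valuations $\mu:\mathrm{Form}\to T_*$ interpret $\&$ by $*$, $\to$ by $\to_*$, $\bot$ by $0$. A pair $(\mathcal{L},T_* )$ is a real-valued logic if $\mathcal{L}$ is an extension of $\mathbf{BL}$ complete with respect to valuations into $T_*$ (i.e. $\vdash_{\mathcal{L}}\alpha$ iff $\mu(\alpha)=1$ for all valuations $\mu$ into $T_*$); any such $T_*$ is said to induce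 $\mathcal{L}$. G\"odel logic $\mathbf{G}$ is $\mathbf{BL}$ extended by the schema $\varphi\to(\varphi\&\varphi)$. Principle (P1) for $\mathcal{L}$: for every algebra of truth values $T_*$ inducing $\mathcal{L}$ and all $\alpha,\beta\in\mathrm{Form}$, $\vdash_{\mathcal{L}}\alpha\leftrightarrow\beta$ holds if and only if for every valuation $\mu:\mathrm{Form}\to T_*$ one has ($\mu(\alpha)=1\iff\mu(\beta)=1$). *)

theory Defs
  imports "HOL-Analysis.Analysis"
begin

datatype form =
    Var nat
  | Bot
  | Imp form form  (infixr "\<^bold>\<rightarrow>" 55)
  | Conj form form  (infixr "\<^bold>&" 60)

definition Iff :: "form \<Rightarrow> form \<Rightarrow> form"  (infix "\<^bold>\<leftrightarrow>" 52) where
  "\<alpha> \<^bold>\<leftrightarrow> \<beta> = (\<alpha> \<^bold>\<rightarrow> \<beta>) \<^bold>& (\<beta> \<^bold>\<rightarrow> \<alpha>)"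

primrec subst_form :: "(nat \<Rightarrow> form) \<Rightarrow> form \<Rightarrow> form" where
  "subst_form \<sigma> (Var n) = \<sigma> n"
| "subst_form \<sigma> Bot = Bot"
| "subst_form \<sigma> (\<alpha> \<^bold>\<rightarrow> \<beta>) = subst_form \<sigma> \<alpha> \<^bold>\<rightarrow> subst_form \<sigma> \<beta>"
| "subst_form \<sigma> (\<alpha> \<^bold>& \<beta>) = subst_form \<sigma> \<alpha> \<^bold>& subst_form \<sigma> \<beta>"

text \<open>The consequence relation of BL is derivability in Hajek's calculus: his axiom schemata
  (A1)--(A7), with modus ponens as the only rule.\<close>

inductive BL_axiom :: "form \<Rightarrow> bool" where
  A1: "BL_axiom ((\<phi> \<^bold>\<rightarrow> \<psi>) \<^bold>\<rightarrow> ((\<psi> \<^bold>\<rightarrow> \<theta>) \<^bold>\<rightarrow> (\<phi> \<^bold>\<rightarrow> \<theta>)))"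
| A2: "BL_axiom ((\<phi> \<^bold>& \<psi>) \<^bold>\<rightarrow> \<phi>)"
| A3: "BL_axiom ((\<phi> \<^bold>& \<psi>) \<^bold>\<rightarrow> (\<psi> \<^bold>& \<phi>))"
| A4: "BL_axiom ((\<phi> \<^bold>& (\<phi> \<^bold>\<rightarrow> \<psi>)) \<^bold>\<rightarrow> (\<psi> \<^bold>& (\<psi> \<^bold>\<rightarrow> \<phi>)))"
| A5a: "BL_axiom ((\<phi> \<^bold>\<rightarrow> (\<psi> \<^bold>\<rightarrow> \<theta>)) \<^bold>\<rightarrow> ((\<phi> \<^bold>& \<psi>) \<^bold>\<rightarrow> \<theta>))"
| A5b: "BL_axiom (((\<phi> \<^bold>& \<psi>) \<^bold>\<rightarrow> \<theta>) \<^bold>\<rightarrow> (\<phi> \<^bold>\<rightarrow> (\<psi> \<^bold>\<rightarrow> \<theta>)))"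
| A6: "BL_axiom (((\<phi> \<^bold>\<rightarrow> \<psi>) \<^bold>\<rightarrow> \<theta>) \<^bold>\<rightarrow> (((\<psi> \<^bold>\<rightarrow> \<phi>) \<^bold>\<rightarrow> \<theta>) \<^bold>\<rightarrow> \<theta>))"
| A7: "BL_axiom (Bot \<^bold>\<rightarrow> \<phi>)"

inductive BL_derives :: "form set \<Rightarrow> form \<Rightarrow> bool" for \<Gamma> where
  premise: "\<phi> \<in> \<Gamma> \<Longrightarrow> BL_derives \<Gamma> \<phi>"
| axiom: "BL_axiom \<phi> \<Longrightarrow> BL_derives \<Gamma> \<phi>"
| mp: "BL_derives \<Gamma> \<phi> \<Longrightarrow> BL_derives \<Gamma> (\<phi> \<^bold>\<rightarrow> \<psi>) \<Longrightarrow> BL_derives \<Gamma> \<psi>"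

definition G_derives :: "form set \<Rightarrow> form \<Rightarrow> bool" where
  "G_derives \<Gamma> = BL_derives (\<Gamma> \<union> {\<phi> \<^bold>\<rightarrow> (\<phi> \<^bold>& \<phi>) | \<phi>. True})"

definition extension_of :: "(form set \<Rightarrow> form \<Rightarrow> bool) \<Rightarrow> form set \<Rightarrow> bool" where
  "extension_of derives L \<longleftrightarrow>
     Bot \<notin> L \<and>
     (\<forall>\<phi>. derives L \<phi> \<longrightarrow> \<phi> \<in> L) \<and>
     (\<forall>\<sigma>. \<forall>\<phi>\<in>L. subst_form \<sigma> \<phi> \<in> L)"

text \<open>Operations on the unit interval are total functions on the reals; only their values on
  the unit interval are constrained or used.\<close>

definition continuous_tnorm :: "(real \<Rightarrow> real \<Rightarrow> real) \<Rightarrow> bool" where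
  "continuous_tnorm tn \<longleftrightarrow>
     (\<forall>a\<in>{0..1}. \<forall>b\<in>{0..1}. tn a b \<in> {0..1}) \<and>
     continuous_on ({0..1} \<times> {0..1}) (\<lambda>(a, b). tn a b) \<and>
     (\<forall>a\<in>{0..1}. \<forall>b\<in>{0..1}. \<forall>c\<in>{0..1}. tn (tn a b) c = tn a (tn b c)) \<and>
     (\<forall>a\<in>{0..1}. \<forall>b\<in>{0..1}. tn a b = tn b a) \<and>
     (\<forall>a\<in>{0..1}. tn a 1 = a) \<and>
     (\<forall>a\<in>{0..1}. \<forall>a'\<in>{0..1}. \<forall>b\<in>{0..1}. \<forall>b'\<in>{0..1}.
        a \<le> a' \<longrightarrow> b \<le> b' \<longrightarrow> tn a b \<le> tn a' b')"

definition residuum :: "(real \<Rightarrow> real \<Rightarrow> real) \<Rightarrow> real \<Rightarrow> real \<Rightarrow> real" where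
  "residuum tn a b = (GREATEST c. c \<in> {0..1} \<and> tn a c \<le> b)"

definition truth_algebra :: "(real \<Rightarrow> real \<Rightarrow> real) \<Rightarrow> real set \<Rightarrow> bool" where
  "truth_algebra tn T \<longleftrightarrow>
     continuous_tnorm tn \<and> T \<subseteq> {0..1} \<and> 0 \<in> T \<and> 1 \<in> T \<and>
     (\<forall>a\<in>T. \<forall>b\<in>T. tn a b \<in> T \<and> residuum tn a b \<in> T)"

definition valuation :: "(real \<Rightarrow> real \<Rightarrow> real) \<Rightarrow> real set \<Rightarrow> (form \<Rightarrow> real) \<Rightarrow> bool" where
  "valuation tn T \<mu> \<longleftrightarrow>
     (\<forall>\<phi>. \<mu> \<phi> \<in> T) \<and>
     \<mu> Bot = 0 \<and>
     (\<forall>\<alpha> \<beta>. \<mu> (\<alpha> \<^bold>& \<beta>) = tn (\<mu> \<alpha>) (\<mu> \<beta>)) \<and>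
     (\<forall>\<alpha> \<beta>. \<mu> (\<alpha> \<^bold>\<rightarrow> \<beta>) = residuum tn (\<mu> \<alpha>) (\<mu> \<beta>))"

definition real_valued_logic :: "form set \<Rightarrow> (real \<Rightarrow> real \<Rightarrow> real) \<Rightarrow> real set \<Rightarrow> bool" where
  "real_valued_logic L tn T \<longleftrightarrow>
     extension_of BL_derives L \<and> truth_algebra tn T \<and>
     (\<forall>\<alpha>. \<alpha> \<in> L \<longleftrightarrow> (\<forall>\<mu>. valuation tn T \<mu> \<longrightarrow> \<mu> \<alpha> = 1))"

definition P1 :: "form set \<Rightarrow> bool" where
  "P1 L \<longleftrightarrow>
     (\<forall>tn T. real_valued_logic L tn T \<longrightarrow>
        (\<forall>\<alpha> \<beta>. (\<alpha> \<^bold>\<leftrightarrow> \<beta>) \<in> L \<longleftrightarrow>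
           (\<forall>\<mu>. valuation tn T \<mu> \<longrightarrow> (\<mu> \<alpha> = 1 \<longleftrightarrow> \<mu> \<beta> = 1))))"

end

theory Submission
  imports Defs
begin

text \<open>
  Since \<open>a * a = 1\<close> forces \<open>a = 1\<close>, principle (P1) applied to \<open>X\<close> and \<open>X & X\<close> yields contraction.
  Conversely, contraction makes every element of an inducing algebra idempotent, so the algebra is
  a Goedel chain. There, collapsing the up-set of any \<open>t > 0\<close> to \<open>1\<close> and fixing everything below
  \<open>t\<close> is an endomorphism. If \<open>\<mu> \<alpha> < \<mu> \<beta>\<close>, composing \<open>\<mu>\<close> with the endomorphism for \<open>t = \<mu> \<beta>\<close>
  gives a valuation with value \<open>1\<close> at \<open>\<beta>\<close> but not at \<open>\<alpha>\<close>.
\<close>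

lemma
  assumes "continuous_tnorm tn"
  shows tnorm_commute: "a \<in> {0..1} \<Longrightarrow> b \<in> {0..1} \<Longrightarrow> tn a b = tn b a"
    and tnorm_one_right: "a \<in> {0..1} \<Longrightarrow> tn a 1 = a"
    and tnorm_mono: "a \<in> {0..1} \<Longrightarrow> a' \<in> {0..1} \<Longrightarrow> b \<in> {0..1} \<Longrightarrow> b' \<in> {0..1} \<Longrightarrow>
      a \<le> a' \<Longrightarrow> b \<le> b' \<Longrightarrow> tn a b \<le> tn a' b'"
    and tnorm_continuous_on: "continuous_on ({0..1} \<times> {0..1}) (\<lambda>(a, b). tn a b)"
  using assms unfolding continuous_tnorm_def by blast+

lemma tnorm_le_left:
  assumes "continuous_tnorm tn" "a \<in> {0..1}" "b \<in> {0..1}"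
  shows "tn a b \<le> a"
  using tnorm_mono[OF assms(1), of a a b 1] tnorm_one_right[OF assms(1), of a] assms by auto

lemma tnorm_le_right:
  assumes "continuous_tnorm tn" "a \<in> {0..1}" "b \<in> {0..1}"
  shows "tn a b \<le> b"
  using tnorm_le_left[OF assms(1,3,2)] tnorm_commute[OF assms] by simp

lemma tnorm_eq_one_iff:
  assumes "continuous_tnorm tn" "a \<in> {0..1}" "b \<in> {0..1}"
  shows "tn a b = 1 \<longleftrightarrow> a = 1 \<and> b = 1"
  using tnorm_le_left[OF assms] tnorm_le_right[OF assms] tnorm_one_right[OF assms(1), of 1] assms
  by auto

text \<open>\<open>GREATEST\<close> is meaningful only if a maximum is attained. Continuity of
  \<open>tn a\<close> makes the set of candidates closed, hence compact in the unit interval, and it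
  contains 0 because \<open>tn a 0\<close> is at most 0.\<close>

lemma residuum_is_greatest:
  assumes "continuous_tnorm tn" "a \<in> {0..1}" "b \<in> {0..1}"
  shows "residuum tn a b \<in> {0..1} \<and> tn a (residuum tn a b) \<le> b \<and>
    (\<forall>c\<in>{0..1}. tn a c \<le> b \<longrightarrow> c \<le> residuum tn a b)"
proof -
  let ?S = "{c \<in> {0..1}. tn a c \<le> b}"
  have "continuous_on {0..1} ((\<lambda>(x, y). tn x y) \<circ> (\<lambda>c. (a, c)))"
    by (intro continuous_on_compose continuous_intros
        continuous_on_subset[OF tnorm_continuous_on[OF assms(1)]]) (use assms in auto)
  then have cont: "continuous_on {0..1} (\<lambda>c. tn a c)"
    by (simp add: o_def)
  have "closed ?S"
    using continuous_closed_preimage[OF cont closed_atLeastAtMost closed_atMost[of b]]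
    by (simp add: vimage_def Int_def)
  moreover have "bounded ?S"
    by (rule bounded_subset[of "{0..1}"]) auto
  ultimately have "compact ?S"
    by (simp add: compact_eq_bounded_closed)
  moreover have "0 \<in> ?S"
    using tnorm_le_right[OF assms(1,2), of 0] assms by auto
  ultimately obtain m where m: "m \<in> ?S" "\<forall>c\<in>?S. c \<le> m"
    using compact_attains_sup[of ?S] by blast
  then have "residuum tn a b = m"
    unfolding residuum_def by (intro Greatest_equality) auto
  then show ?thesis
    using m by auto
qed

lemma
  assumes "continuous_tnorm tn" "a \<in> {0..1}" "b \<in> {0..1}"
  shows residuum_range: "residuum tn a b \<in> {0..1}"
    and tnorm_residuum_le: "tn a (residuum tn a b) \<le> b"
    and le_residuum: "c \<in> {0..1} \<Longrightarrow> tn a c \<le> b \<Longrightarrow> c \<le> residuum tn a b"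
  using residuum_is_greatest[OF assms] by auto

text \<open>The largest possible candidate is 1, and it qualifies exactly when
  \<open>tn a 1\<close>, which is \<open>a\<close>, is at most \<open>b\<close>.\<close>

lemma residuum_eq_one_iff:
  assumes "continuous_tnorm tn" "a \<in> {0..1}" "b \<in> {0..1}"
  shows "residuum tn a b = 1 \<longleftrightarrow> a \<le> b"
proof
  assume "residuum tn a b = 1"
  then show "a \<le> b"
    using tnorm_residuum_le[OF assms] tnorm_one_right[OF assms(1,2)] by simp
next
  assume "a \<le> b"
  then have "1 \<le> residuum tn a b"
    using le_residuum[OF assms, of 1] tnorm_one_right[OF assms(1,2)] by simp
  then show "residuum tn a b = 1"
    using residuum_range[OF assms] by auto
qed

text \<open>Monotonicity squeezes the product: the smaller argument equals its own square, which is
  at most \<open>tn a b\<close>, while \<open>tn a b\<close> lies below both arguments.\<close>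

lemma tnorm_idempotent_eq_min:
  assumes "continuous_tnorm tn" "a \<in> {0..1}" "b \<in> {0..1}" "tn a a = a" "tn b b = b"
  shows "tn a b = min a b"
proof (rule antisym)
  show "tn a b \<le> min a b"
    using tnorm_le_left[OF assms(1-3)] tnorm_le_right[OF assms(1-3)] by simp
  show "min a b \<le> tn a b"
    using tnorm_mono[OF assms(1), of a a a b] tnorm_mono[OF assms(1), of b a b b] assms
    by (cases "a \<le> b") auto
qed

text \<open>Idempotence is demanded on \<open>T\<close> alone; between the points of
  \<open>T\<close> the t-norm may still differ from the minimum.\<close>

locale idempotent_truth_algebra =
  fixes tn :: "real \<Rightarrow> real \<Rightarrow> real" and T :: "real set"
  assumes truth_algebra: "truth_algebra tn T"
    and idempotent: "a \<in> T \<Longrightarrow> tn a a = a"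
begin

lemma tnorm: "continuous_tnorm tn"
  and carrier_unit: "a \<in> T \<Longrightarrow> a \<in> {0..1}"
  and one_in_carrier: "1 \<in> T"
  and residuum_closed: "a \<in> T \<Longrightarrow> b \<in> T \<Longrightarrow> residuum tn a b \<in> T"
  using truth_algebra unfolding truth_algebra_def by blast+

lemma tnorm_eq_min: "a \<in> T \<Longrightarrow> b \<in> T \<Longrightarrow> tn a b = min a b"
  by (intro tnorm_idempotent_eq_min tnorm carrier_unit idempotent)

lemma residuum_eq:
  assumes "a \<in> T" "b \<in> T"
  shows "residuum tn a b = (if a \<le> b then 1 else b)"
proof (cases "a \<le> b")
  case True
  then show ?thesis
    using residuum_eq_one_iff[OF tnorm] assms carrier_unit by simp
next
  case False
  note unit = assms[THEN carrier_unit]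
  \<comment> \<open>The residuum is a maximum over the whole unit interval, where \<open>tn\<close>
    need not be \<open>min\<close>. Closure of \<open>T\<close> puts this maximum into
    \<open>T\<close>, so that \<open>tnorm_eq_min\<close> applies to it.\<close>
  have "min a (residuum tn a b) \<le> b"
    using tnorm_residuum_le[OF tnorm unit] tnorm_eq_min[OF assms(1) residuum_closed[OF assms]]
    by simp
  moreover have "b \<le> residuum tn a b"
    using le_residuum[OF tnorm unit unit(2) tnorm_le_right[OF tnorm unit]] .
  ultimately show ?thesis
    using False by auto
qed

text \<open>The collapsing map is monotone, so it respects \<open>min\<close>; it fixes 0 since
  \<open>t\<close> is positive. For the residuum only the case \<open>b < a\<close> is of interest:
  if \<open>t\<close> is at most \<open>b\<close>, both arguments become 1 and so does the value
  \<open>b\<close>; otherwise \<open>b\<close> is fixed and stays strictly below the image of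
  \<open>a\<close>.\<close>

lemma valuation_collapse:
  assumes "valuation tn T \<mu>" "0 < t"
  shows "valuation tn T (\<lambda>\<phi>. if t \<le> \<mu> \<phi> then 1 else \<mu> \<phi>)"
proof -
  let ?h = "\<lambda>x. if t \<le> x then 1 else x"
  have \<mu>: "\<mu> \<phi> \<in> T" "\<mu> Bot = 0" "\<mu> (\<alpha> \<^bold>& \<beta>) = tn (\<mu> \<alpha>) (\<mu> \<beta>)"
    "\<mu> (\<alpha> \<^bold>\<rightarrow> \<beta>) = residuum tn (\<mu> \<alpha>) (\<mu> \<beta>)" for \<phi> \<alpha> \<beta>
    using assms(1) unfolding valuation_def by auto
  have h: "?h a \<in> T" if "a \<in> T" for a
    using that one_in_carrier by simp
  have h_tnorm: "?h (tn a b) = tn (?h a) (?h b)" if "a \<in> T" "b \<in> T" for a b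
    unfolding tnorm_eq_min[OF that] tnorm_eq_min[OF that[THEN h]]
    using that[THEN carrier_unit] by (simp add: min_def)
  have h_residuum: "?h (residuum tn a b) = residuum tn (?h a) (?h b)"
    if "a \<in> T" "b \<in> T" for a b
    unfolding residuum_eq[OF that] residuum_eq[OF that[THEN h]]
    using that[THEN carrier_unit] by simp
  show ?thesis
    unfolding valuation_def
    using h[OF \<mu>(1)] h_tnorm[OF \<mu>(1) \<mu>(1)] h_residuum[OF \<mu>(1) \<mu>(1)] assms(2)
    by (simp only: \<mu>(2-4)) simp
qed

end

lemma valuation_range:
  assumes "truth_algebra tn T" "valuation tn T \<mu>"
  shows "\<mu> \<phi> \<in> {0..1}"
  using assms unfolding truth_algebra_def valuation_def by blast

lemma valuation_Imp_eq_one_iff: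
  assumes "truth_algebra tn T" "valuation tn T \<mu>"
  shows "\<mu> (\<alpha> \<^bold>\<rightarrow> \<beta>) = 1 \<longleftrightarrow> \<mu> \<alpha> \<le> \<mu> \<beta>"
  using residuum_eq_one_iff[OF _ valuation_range[OF assms] valuation_range[OF assms]] assms
  unfolding truth_algebra_def valuation_def by auto

lemma valuation_Conj_eq_one_iff:
  assumes "truth_algebra tn T" "valuation tn T \<mu>"
  shows "\<mu> (\<alpha> \<^bold>& \<beta>) = 1 \<longleftrightarrow> \<mu> \<alpha> = 1 \<and> \<mu> \<beta> = 1"
  using tnorm_eq_one_iff[OF _ valuation_range[OF assms] valuation_range[OF assms]] assms
  unfolding truth_algebra_def valuation_def by auto

lemma valuation_Iff_eq_one_iff:
  assumes "truth_algebra tn T" "valuation tn T \<mu>"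
  shows "\<mu> (\<alpha> \<^bold>\<leftrightarrow> \<beta>) = 1 \<longleftrightarrow> \<mu> \<alpha> = \<mu> \<beta>"
  unfolding Iff_def
  using valuation_Conj_eq_one_iff[OF assms] valuation_Imp_eq_one_iff[OF assms] by auto

text \<open>Extends an assignment of the variables to all formulas, which yields valuations with
  prescribed values at the variables.\<close>

primrec truth_value :: "(real \<Rightarrow> real \<Rightarrow> real) \<Rightarrow> (nat \<Rightarrow> real) \<Rightarrow> form \<Rightarrow> real" where
  "truth_value tn e (Var n) = e n"
| "truth_value tn e Bot = 0"
| "truth_value tn e (\<alpha> \<^bold>\<rightarrow> \<beta>) = residuum tn (truth_value tn e \<alpha>) (truth_value tn e \<beta>)"
| "truth_value tn e (\<alpha> \<^bold>& \<beta>) = tn (truth_value tn e \<alpha>) (truth_value tn e \<beta>)"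

lemma valuation_truth_value:
  assumes "truth_algebra tn T" "\<And>n. e n \<in> T"
  shows "valuation tn T (truth_value tn e)"
proof -
  have "truth_value tn e \<phi> \<in> T" for \<phi>
    using assms by (induction \<phi>) (auto simp: truth_algebra_def)
  then show ?thesis
    by (simp add: valuation_def)
qed

text \<open>Contraction for a single variable suffices, since any element of \<open>T\<close> is its
  value under a constant assignment.\<close>

lemma idempotent_truth_algebra_of_contraction:
  assumes "truth_algebra tn T"
    and contr: "\<And>\<mu>. valuation tn T \<mu> \<Longrightarrow> \<mu> (Var n \<^bold>\<rightarrow> Var n \<^bold>& Var n) = 1"
  shows "idempotent_truth_algebra tn T"
proof
  fix a assume "a \<in> T"
  then have \<mu>: "valuation tn T (truth_value tn (\<lambda>_. a))" (is "valuation tn T ?\<mu>")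
    by (intro valuation_truth_value assms)
  have "a \<le> tn a a"
    using valuation_Imp_eq_one_iff[OF assms(1) \<mu>] contr[OF \<mu>] by (metis truth_value.simps(1,4))
  moreover have "tn a a \<le> a"
    using assms(1) \<open>a \<in> T\<close> by (intro tnorm_le_left) (auto simp: truth_algebra_def)
  ultimately show "tn a a = a"
    by simp
qed (rule assms(1))

text \<open>\<open>G_derives\<close> adds the contraction schema as premises. Once all its instances
  belong to \<open>L\<close>, these premises add nothing, and both consequence relations agree at
  \<open>L\<close>.\<close>

lemma extension_of_G_iff:
  "extension_of G_derives L \<longleftrightarrow>
    extension_of BL_derives L \<and> (\<forall>\<phi>. (\<phi> \<^bold>\<rightarrow> \<phi> \<^bold>& \<phi>) \<in> L)" (is "?l \<longleftrightarrow> ?r")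
proof
  assume l: ?l
  have "G_derives L \<phi>" if "BL_derives L \<phi>" for \<phi>
    unfolding G_derives_def using that
    by induction (auto intro: BL_derives.intros)
  moreover have "G_derives L (\<phi> \<^bold>\<rightarrow> \<phi> \<^bold>& \<phi>)" for \<phi>
    unfolding G_derives_def by (rule BL_derives.premise) auto
  ultimately show ?r
    using l unfolding extension_of_def by blast
next
  assume r: ?r
  then have "L \<union> {\<phi> \<^bold>\<rightarrow> (\<phi> \<^bold>& \<phi>) | \<phi>. True} = L"
    by auto
  then have "G_derives L = BL_derives L"
    by (simp add: G_derives_def)
  then show ?l
    using r by (simp add: extension_of_def)
qed

theorem theoremI:
  fixes L :: "form set" and tn :: "real \<Rightarrow> real \<Rightarrow> real" and T :: "real set"
  assumes "real_valued_logic L tn T"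
  shows "P1 L \<longleftrightarrow> extension_of G_derives L"
proof
  assume "P1 L"
  have ext: "extension_of BL_derives L" and alg: "truth_algebra tn T"
    and complete: "\<And>\<alpha>. \<alpha> \<in> L \<longleftrightarrow> (\<forall>\<mu>. valuation tn T \<mu> \<longrightarrow> \<mu> \<alpha> = 1)"
    using assms unfolding real_valued_logic_def by auto
  have "(\<phi> \<^bold>\<leftrightarrow> \<phi> \<^bold>& \<phi>) \<in> L" for \<phi>
    using \<open>P1 L\<close> assms valuation_Conj_eq_one_iff[OF alg] unfolding P1_def by blast
  then have "(\<phi> \<^bold>\<rightarrow> \<phi> \<^bold>& \<phi>) \<in> L" for \<phi>
    unfolding complete Iff_def using valuation_Conj_eq_one_iff[OF alg] by blast
  then show "extension_of G_derives L"
    using ext by (simp add: extension_of_G_iff)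
next
  assume G: "extension_of G_derives L"
  show "P1 L"
    unfolding P1_def
  proof (intro allI impI)
    \<comment> \<open>These \<open>tn\<close> and \<open>T\<close> shadow the given ones, as (P1)
      speaks of every algebra inducing \<open>L\<close>. Each of them validates contraction, because
      completeness ties it to the same \<open>L\<close>.\<close>
    fix tn T \<alpha> \<beta>
    assume "real_valued_logic L tn T"
    then have alg: "truth_algebra tn T"
      and complete: "\<And>\<alpha>. \<alpha> \<in> L \<longleftrightarrow> (\<forall>\<mu>. valuation tn T \<mu> \<longrightarrow> \<mu> \<alpha> = 1)"
      unfolding real_valued_logic_def by auto
    interpret idempotent_truth_algebra tn T
      using alg G complete
      by (intro idempotent_truth_algebra_of_contraction[where n = 0])
        (auto simp: extension_of_G_iff)
    \<comment> \<open>Stated one-sidedly for fresh formulas, so that it can be used twice with the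
      roles exchanged.\<close>
    have le: "\<mu> \<beta> \<le> \<mu> \<alpha>"
      if sep: "\<And>\<mu>. valuation tn T \<mu> \<Longrightarrow> \<mu> \<beta> = 1 \<Longrightarrow> \<mu> \<alpha> = 1" and \<mu>: "valuation tn T \<mu>"
      for \<alpha> \<beta> \<mu>
    proof (rule ccontr)
      assume less: "\<not> \<mu> \<beta> \<le> \<mu> \<alpha>"
      have unit: "\<mu> \<alpha> \<in> {0..1}" "\<mu> \<beta> \<in> {0..1}"
        using valuation_range[OF alg \<mu>] by auto
      then have "0 < \<mu> \<beta>"
        using less by simp
      \<comment> \<open>Here \<open>this\<close> sets the threshold to \<mu> \<beta>. The collapsed
        valuation gives \<beta> the value 1 but leaves \<mu> \<alpha> unchanged, which is below
        \<mu> \<beta> and hence below 1.\<close>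
      from sep[OF valuation_collapse[OF \<mu> this]] show False
        using less unit by auto
    qed
    show "(\<alpha> \<^bold>\<leftrightarrow> \<beta>) \<in> L \<longleftrightarrow>
        (\<forall>\<mu>. valuation tn T \<mu> \<longrightarrow> (\<mu> \<alpha> = 1 \<longleftrightarrow> \<mu> \<beta> = 1))"
    proof
      assume "(\<alpha> \<^bold>\<leftrightarrow> \<beta>) \<in> L"
      then have "\<mu> \<alpha> = \<mu> \<beta>" if "valuation tn T \<mu>" for \<mu>
        using that valuation_Iff_eq_one_iff[OF alg that] unfolding complete by blast
      then show "\<forall>\<mu>. valuation tn T \<mu> \<longrightarrow> (\<mu> \<alpha> = 1 \<longleftrightarrow> \<mu> \<beta> = 1)"
        by metis
    next
      assume same: "\<forall>\<mu>. valuation tn T \<mu> \<longrightarrow> (\<mu> \<alpha> = 1 \<longleftrightarrow> \<mu> \<beta> = 1)"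
      have "\<mu> \<alpha> = \<mu> \<beta>" if "valuation tn T \<mu>" for \<mu>
        by (rule antisym; rule le[OF _ that]) (use same in simp_all)
      then show "(\<alpha> \<^bold>\<leftrightarrow> \<beta>) \<in> L"
        unfolding complete using valuation_Iff_eq_one_iff[OF alg] by simp
    qed
  qed
qed

end
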